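(* Let $\Gamma$ be a finite simple undirected graph that is not complete and that has a dominating vertex $x$. Then $\Gamma$ is minimally edge connected if and only if $x$ is the only dominating vertex of $\Gamma$ and the graph $\Gamma - \{x\}$ (obtained by deleting the vertex $x$) is regular.
   Context: A vertex $u$ of a graph $\Gamma$ is dominating if $u$ is adjacent to every other vertex of $\Gamma$. A graph is complete if any two distinct vertices are adjacent, and regular if all its vertices have the same degree. The edge connectivity $\kappa'(\Gamma)$ is the minimum size of a set $S$ of edges such that $\Gamma - S$ is disconnected or has only one vertex (so $\kappa'(\Gamma)=0$ if $\Gamma$ is already disconnected or has one vertex). $\Gamma$ is minimally edge connected if $\kappa'(\Gamma-\epsilon)=\kappa'(\Gamma)-1$ for every edge $\epsilon$ of $\Gamma$, where $\Gamma-\epsilon$ is $\Gamma$ with the edge $\epsilon$ removed (all vertices kept). *)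

theory Defs
  imports Main
begin

text \<open>
  A simple undirected graph is given by a vertex set \<open>V\<close> and a set \<open>E\<close> of
  two-element subsets of \<open>V\<close>.
\<close>

definition finite_simple_graph :: "'a set \<Rightarrow> 'a set set \<Rightarrow> bool" where
  "finite_simple_graph V E \<longleftrightarrow> finite V \<and> (\<forall>e\<in>E. e \<subseteq> V \<and> card e = 2)"

definition adjacent :: "'a set set \<Rightarrow> 'a \<Rightarrow> 'a \<Rightarrow> bool" where
  "adjacent E u v \<longleftrightarrow> {u, v} \<in> E"

definition dominating :: "'a set \<Rightarrow> 'a set set \<Rightarrow> 'a \<Rightarrow> bool" where
  "dominating V E u \<longleftrightarrow> u \<in> V \<and> (\<forall>v\<in>V. v \<noteq> u \<longrightarrow> adjacent E u v)"

definition complete_graph :: "'a set \<Rightarrow> 'a set set \<Rightarrow> bool" where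
  "complete_graph V E \<longleftrightarrow> (\<forall>u\<in>V. \<forall>v\<in>V. u \<noteq> v \<longrightarrow> adjacent E u v)"

definition degree :: "'a set set \<Rightarrow> 'a \<Rightarrow> nat" where
  "degree E v = card {e \<in> E. v \<in> e}"

definition regular_graph :: "'a set \<Rightarrow> 'a set set \<Rightarrow> bool" where
  "regular_graph V E \<longleftrightarrow> (\<exists>r. \<forall>v\<in>V. degree E v = r)"

definition connected_graph :: "'a set \<Rightarrow> 'a set set \<Rightarrow> bool" where
  "connected_graph V E \<longleftrightarrow> (\<forall>u\<in>V. \<forall>v\<in>V. (adjacent E)\<^sup>*\<^sup>* u v)"

text \<open>
  On a nonempty finite simple graph the minimum below is over a nonempty set:
  \<open>S = E\<close> always qualifies.
\<close>

definition edge_connectivity :: "'a set \<Rightarrow> 'a set set \<Rightarrow> nat" where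
  "edge_connectivity V E =
     (LEAST k. \<exists>S\<subseteq>E. card S = k \<and> (\<not> connected_graph V (E - S) \<or> card V = 1))"

text \<open>
  The subtraction is taken in the integers: with truncated subtraction, a
  disconnected graph would count as minimally edge connected.
\<close>

definition minimally_edge_connected :: "'a set \<Rightarrow> 'a set set \<Rightarrow> bool" where
  "minimally_edge_connected V E \<longleftrightarrow>
     (\<forall>e\<in>E. int (edge_connectivity V (E - {e})) = int (edge_connectivity V E) - 1)"

definition delete_vertex_edges :: "'a set set \<Rightarrow> 'a \<Rightarrow> 'a set set" where
  "delete_vertex_edges E x = {e \<in> E. x \<notin> e}"

end

theory Submission
  imports Defs
begin

text \<open>
  Let \<open>A\<close> be a nonempty set of vertices avoiding the dominating vertex \<open>x\<close>. For every
  \<open>y \<in> A\<close>, the edge cut of \<open>A\<close> has at least \<open>degree y\<close> elements: an edge from \<open>y\<close> to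
  \<open>w \<in> A\<close> can be traded for the edge \<open>{x, w}\<close>. As every disconnecting set contains such a
  cut, the edge connectivity is the least degree of a vertex other than \<open>x\<close>. If deleting the
  edge \<open>{x, y}\<close> lowers it, then \<open>{x, y}\<close> lies in a minimum disconnecting set, hence
  \<open>y\<close> belongs to the set \<open>A\<close> of a minimum cut and has least degree. So minimal edge
  connectivity means that all vertices other than \<open>x\<close> have the same degree.
\<close>

section \<open>Edge cuts and degrees\<close>

definition edge_cut :: "'a set set \<Rightarrow> 'a set \<Rightarrow> 'a set set" where
  "edge_cut E A = {e \<in> E. e \<inter> A \<noteq> {} \<and> \<not> e \<subseteq> A}"

lemma finite_simple_graph_finite_edges:
  assumes "finite_simple_graph V E"
  shows "finite E"
proof -
  have "E \<subseteq> Pow V" "finite (Pow V)"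
    using assms by (auto simp: finite_simple_graph_def)
  then show ?thesis
    by (rule finite_subset)
qed

lemma finite_simple_graph_edgeE:
  assumes "finite_simple_graph V E" "e \<in> E" "v \<in> e"
  obtains w where "e = {v, w}" "w \<noteq> v" "v \<in> V" "w \<in> V"
proof -
  obtain a b where "e = {a, b}" "a \<noteq> b"
    using assms by (auto simp: finite_simple_graph_def card_2_iff)
  moreover have "e \<subseteq> V"
    using assms by (auto simp: finite_simple_graph_def)
  ultimately show ?thesis
    using that assms(3) by (auto simp: doubleton_eq_iff)
qed

lemma degree_eq_card_neighbours:
  assumes "finite_simple_graph V E"
  shows "degree E v = card {w. adjacent E v w}"
proof -
  have "{e \<in> E. v \<in> e} \<subseteq> (\<lambda>w. {v, w}) ` {w. adjacent E v w}"
  proof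
    fix e
    assume "e \<in> {e \<in> E. v \<in> e}"
    then have e: "e \<in> E" "v \<in> e"
      by auto
    obtain w where "e = {v, w}"
      using finite_simple_graph_edgeE [OF assms e] by blast
    with e show "e \<in> (\<lambda>w. {v, w}) ` {w. adjacent E v w}"
      by (auto simp: adjacent_def)
  qed
  then have "{e \<in> E. v \<in> e} = (\<lambda>w. {v, w}) ` {w. adjacent E v w}"
    by (auto simp: adjacent_def)
  moreover have "inj_on (\<lambda>w. {v, w}) {w. adjacent E v w}"
    by (auto simp: inj_on_def doubleton_eq_iff)
  ultimately show ?thesis
    by (simp add: degree_def card_image)
qed

lemma disconnected_if_isolated:
  assumes "v \<in> V" "V \<noteq> {v}" "\<And>w. \<not> adjacent E v w"
  shows "\<not> connected_graph V E"
proof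
  assume "connected_graph V E"
  moreover obtain w where "w \<in> V" "w \<noteq> v"
    using assms by blast
  ultimately have "(adjacent E)\<^sup>*\<^sup>* v w"
    using assms(1) by (auto simp: connected_graph_def)
  then show False
    using \<open>w \<noteq> v\<close> assms(3) by (auto elim: converse_rtranclpE)
qed

text \<open>Take for \<open>A\<close> the vertices that \<open>x\<close> cannot reach once
  \<open>S\<close> is removed. An edge of the cut outside \<open>S\<close> would make its end in
  \<open>A\<close> reachable. Taking the side without \<open>x\<close> leaves \<open>x\<close> free
  as the outer end in \<open>degree_le_card_edge_cut\<close>.\<close>

lemma disconnecting_set_contains_cut:
  assumes "finite_simple_graph V E" "x \<in> V" "\<not> connected_graph V (E - S)"
  obtains A where "A \<subseteq> V" "A \<noteq> {}" "x \<notin> A" "edge_cut E A \<subseteq> S"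
proof -
  let ?R = "(adjacent (E - S))\<^sup>*\<^sup>*"
  define A where "A = {v \<in> V. \<not> ?R x v}"
  have "symp (adjacent (E - S))"
    by (auto simp: symp_def adjacent_def insert_commute)
  then have sym: "?R u v \<Longrightarrow> ?R v u" for u v
    by (metis symp_rtranclp sympD)
  have "A \<noteq> {}"
  proof
    assume "A = {}"
    \<comment> \<open>If \<open>x\<close> reaches every vertex, any two vertices are joined by a
      walk through \<open>x\<close>.\<close>
    then have "connected_graph V (E - S)"
      unfolding connected_graph_def A_def using sym by (blast intro: rtranclp_trans [of _ _ x])
    with assms(3) show False
      by simp
  qed
  moreover have "edge_cut E A \<subseteq> S"
  proof
    fix e
    assume e: "e \<in> edge_cut E A"
    then obtain v where v: "v \<in> e" "v \<in> A" "e \<in> E"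
      by (auto simp: edge_cut_def)
    then obtain w where w: "e = {v, w}" "w \<in> V"
      using finite_simple_graph_edgeE [OF assms(1) v(3,1)] by blast
    have "?R x w"
      using e v w by (auto simp: edge_cut_def A_def)
    show "e \<in> S"
    proof (rule ccontr)
      assume "e \<notin> S"
      then have "adjacent (E - S) w v"
        using v w by (simp add: adjacent_def insert_commute)
      with \<open>?R x w\<close> have "?R x v"
        by (rule rtranclp.rtrancl_into_rtrancl)
      with v show False
        by (simp add: A_def)
    qed
  qed
  moreover have "A \<subseteq> V" "x \<notin> A"
    by (auto simp: A_def)
  ultimately show ?thesis
    using that by blast
qed

lemma degree_le_card_edge_cut:
  assumes G: "finite_simple_graph V E" and dom: "dominating V E x"
    and A: "A \<subseteq> V" "x \<notin> A" and y: "y \<in> A"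
  shows "degree E y \<le> card (edge_cut E A)"
proof -
  let ?C = "{e \<in> edge_cut E A. y \<in> e}" and ?B = "A - {y}"
  have fE: "finite E"
    using G by (rule finite_simple_graph_finite_edges)
  have fC: "finite (edge_cut E A)"
    using fE by (auto simp: edge_cut_def)
  have fB: "finite ?B"
    using G A by (auto simp: finite_simple_graph_def intro: finite_subset)
  have "{e \<in> E. y \<in> e} \<subseteq> ?C \<union> (\<lambda>w. {y, w}) ` ?B"
  proof
    fix e
    assume "e \<in> {e \<in> E. y \<in> e}"
    then have e: "e \<in> E" "y \<in> e"
      by auto
    obtain w where "e = {y, w}" "w \<noteq> y"
      using finite_simple_graph_edgeE [OF G e] by blast
    with e show "e \<in> ?C \<union> (\<lambda>w. {y, w}) ` ?B"
      using y by (auto simp: edge_cut_def)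
  qed
  then have "degree E y \<le> card (?C \<union> (\<lambda>w. {y, w}) ` ?B)"
    unfolding degree_def using fC fB by (intro card_mono) auto
  also have "\<dots> \<le> card ?C + card ((\<lambda>w. {y, w}) ` ?B)"
    by (rule card_Un_le)
  also have "\<dots> \<le> card ?C + card ?B"
    using fB by (simp add: card_image_le)
  also have "card ?B = card ((\<lambda>w. {x, w}) ` ?B)"
    by (rule card_image [symmetric]) (auto simp: inj_on_def doubleton_eq_iff)
  \<comment> \<open>The union is disjoint: every edge in \<open>?C\<close> contains
    \<open>y\<close>, whereas no \<open>{x, w}\<close> with \<open>w\<close> in \<open>?B\<close>
    does.\<close>
  also have "card ?C + \<dots> = card (?C \<union> (\<lambda>w. {x, w}) ` ?B)"
    using fC fB A y by (subst card_Un_disjoint) auto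
  also have "\<dots> \<le> card (edge_cut E A)"
  proof (rule card_mono [OF fC])
    show "?C \<union> (\<lambda>w. {x, w}) ` ?B \<subseteq> edge_cut E A"
      using dom A by (auto simp: edge_cut_def dominating_def adjacent_def)
  qed
  finally show ?thesis .
qed

section \<open>Bounds for the edge connectivity\<close>

lemma edge_connectivity_le_card:
  assumes "S \<subseteq> E" "\<not> connected_graph V (E - S)"
  shows "edge_connectivity V E \<le> card S"
  unfolding edge_connectivity_def using assms by (intro Least_le) auto

text \<open>Removing all edges at \<open>v\<close> isolates it, which disconnects the graph as soon
  as there is another vertex.\<close>

lemma edge_connectivity_le_degree:
  assumes "v \<in> V" "V \<noteq> {v}"
  shows "edge_connectivity V E \<le> degree E v"
  unfolding degree_def using assms
  by (intro edge_connectivity_le_card disconnected_if_isolated) (auto simp: adjacent_def)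

lemma edge_connectivity_attained:
  assumes "v \<in> V" "V \<noteq> {v}"
  obtains S where "S \<subseteq> E" "card S = edge_connectivity V E" "\<not> connected_graph V (E - S)"
proof -
  let ?P = "\<lambda>k. \<exists>S\<subseteq>E. card S = k \<and> (\<not> connected_graph V (E - S) \<or> card V = 1)"
  \<comment> \<open>\<open>S = E\<close> isolates every vertex, so the set under
    \<open>LEAST\<close> is nonempty and its least element is attained.\<close>
  have "\<not> connected_graph V (E - E)"
    using assms by (intro disconnected_if_isolated) (auto simp: adjacent_def)
  then have "?P (card E)"
    by blast
  then have "?P (edge_connectivity V E)"
    unfolding edge_connectivity_def by (rule LeastI)
  moreover have "card V \<noteq> 1"
    using assms by (auto simp: card_1_singleton_iff)
  ultimately show ?thesis
    using that by blast
qed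

section \<open>Degrees in the presence of a dominating vertex\<close>

lemma degree_delete_vertex_edges:
  assumes "finite_simple_graph V E" "dominating V E x" "v \<in> V - {x}"
  shows "degree E v = Suc (degree (delete_vertex_edges E x) v)"
proof -
  \<comment> \<open>Deleting \<open>x\<close> costs \<open>v\<close> exactly one edge, the one
    joining it to \<open>x\<close>. Hence regularity after the deletion amounts to equal degrees in
    \<open>E\<close> away from \<open>x\<close>.\<close>
  have "{e \<in> E. v \<in> e} = insert {x, v} {e \<in> delete_vertex_edges E x. v \<in> e}"
  proof -
    have "{x, v} \<in> E"
      using assms by (auto simp: dominating_def adjacent_def)
    moreover have "e = {x, v}" if "e \<in> E" "v \<in> e" "x \<in> e" for e
      using finite_simple_graph_edgeE [OF assms(1) that(1,2)] that(3) assms(3) by blast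
    ultimately show ?thesis
      unfolding delete_vertex_edges_def by blast
  qed
  moreover have "finite {e \<in> delete_vertex_edges E x. v \<in> e}"
    using finite_simple_graph_finite_edges [OF assms(1)] by (simp add: delete_vertex_edges_def)
  ultimately show ?thesis
    by (simp add: degree_def delete_vertex_edges_def)
qed

text \<open>A dominating vertex has the largest possible degree \<open>card V - 1\<close>. If this
  is also the least degree, every vertex is adjacent to all others. This rules out a second
  dominating vertex in the main theorem.\<close>

lemma complete_if_dominating_degree:
  assumes G: "finite_simple_graph V E"
    and y: "dominating V E y" and deg: "\<And>v. v \<in> V \<Longrightarrow> degree E y \<le> degree E v"
  shows "complete_graph V E"
  unfolding complete_graph_def
proof (intro ballI impI)
  fix u v
  assume uv: "u \<in> V" "v \<in> V" "u \<noteq> v"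
  have fV: "finite V"
    using G by (simp add: finite_simple_graph_def)
  have nbr: "{w. adjacent E u w} \<subseteq> V - {u}" for u
    using G by (auto simp: adjacent_def finite_simple_graph_def)
  have "card V - 1 = card (V - {y})"
    using y by (simp add: dominating_def)
  also have "\<dots> \<le> degree E y"
    unfolding degree_eq_card_neighbours [OF G] using y fV nbr [of y]
    by (intro card_mono) (auto simp: dominating_def intro: finite_subset)
  also have "\<dots> \<le> degree E u"
    using deg uv by simp
  finally have "card (V - {u}) \<le> card {w. adjacent E u w}"
    using uv by (simp add: degree_eq_card_neighbours [OF G])
  then have "{w. adjacent E u w} = V - {u}"
    using nbr [of u] fV by (intro card_seteq) auto
  then show "adjacent E u v"
    using uv by auto
qed

section \<open>The two directions of the equivalence\<close>

lemma minimally_edge_connected_imp_degree: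
  assumes G: "finite_simple_graph V E" and dom: "dominating V E x"
    and min: "minimally_edge_connected V E" and y: "y \<in> V - {x}"
  shows "degree E y = edge_connectivity V E"
proof -
  let ?e = "{x, y}"
  have x: "x \<in> V" "V \<noteq> {x}"
    using dom y by (auto simp: dominating_def)
  have ub: "edge_connectivity V E \<le> degree E v" if "v \<in> V" "v \<noteq> x" for v
    using that x by (intro edge_connectivity_le_degree) auto
  have "?e \<in> E"
    using dom y by (auto simp: dominating_def adjacent_def)
  then have "int (edge_connectivity V (E - {?e})) = int (edge_connectivity V E) - 1"
    using min by (simp add: minimally_edge_connected_def)
  then have ec: "edge_connectivity V E = Suc (edge_connectivity V (E - {?e}))"
    by linarith
  obtain S where S: "S \<subseteq> E - {?e}" "card S = edge_connectivity V (E - {?e})"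
      "\<not> connected_graph V (E - {?e} - S)"
    using edge_connectivity_attained [OF x] .
  have fS: "finite S"
    using finite_simple_graph_finite_edges [OF G] S(1) by (meson finite_Diff finite_subset)
  \<comment> \<open>Together with \<open>?e\<close>, the set \<open>S\<close> disconnects the
    original graph, and its size is then the edge connectivity.\<close>
  have "E - {?e} - S = E - insert ?e S"
    by auto
  then obtain A where A: "A \<subseteq> V" "A \<noteq> {}" "x \<notin> A" "edge_cut E A \<subseteq> insert ?e S"
    using disconnecting_set_contains_cut [OF G x(1)] S(3) by metis
  \<comment> \<open>Otherwise neither end of \<open>?e\<close> lies in \<open>A\<close>, so the cut
    is contained in \<open>S\<close>, and a vertex of \<open>A\<close> would have degree below the
    edge connectivity.\<close>
  have "y \<in> A"
  proof (rule ccontr)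
    assume "y \<notin> A"
    then have "edge_cut E A \<subseteq> S"
      using A by (auto simp: edge_cut_def)
    then have "card (edge_cut E A) \<le> card S"
      using fS by (intro card_mono)
    moreover obtain z where z: "z \<in> A"
      using A by auto
    ultimately have "degree E z < edge_connectivity V E"
      using degree_le_card_edge_cut [OF G dom A(1,3) z] S ec by simp
    with ub [of z] z A show False
      by auto
  qed
  then have "degree E y \<le> card (edge_cut E A)"
    using degree_le_card_edge_cut [OF G dom A(1,3)] by simp
  also have "\<dots> \<le> card (insert ?e S)"
    using A fS by (intro card_mono) auto
  also have "\<dots> = edge_connectivity V E"
    using fS S ec by (simp add: card_insert_if) blast
  finally show ?thesis
    using ub [of y] y by auto
qed

text \<open>Every edge has an end \<open>v\<close> other than \<open>x\<close>. Removing the edge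
  lowers the degree of \<open>v\<close>, and with it the edge connectivity, below \<open>d\<close>.
  The drop is at most one, because returning the edge to a disconnecting set adds at most one
  element.\<close>

lemma minimally_edge_connected_if_degree:
  assumes G: "finite_simple_graph V E" and dom: "dominating V E x"
    and deg: "\<And>v. v \<in> V - {x} \<Longrightarrow> degree E v = d"
  shows "minimally_edge_connected V E"
  unfolding minimally_edge_connected_def
proof
  fix e
  assume e: "e \<in> E"
  have fE: "finite E"
    using G by (rule finite_simple_graph_finite_edges)
  obtain v where v: "v \<in> e" "v \<in> V - {x}"
  proof -
    have "card e = 2" "e \<subseteq> V"
      using G e by (auto simp: finite_simple_graph_def)
    then show ?thesis
      using that by (auto simp: card_2_iff)
  qed
  have x: "x \<in> V" "V \<noteq> {x}" "V \<noteq> {v}"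
    using dom v by (auto simp: dominating_def)
  \<comment> \<open>Any vertex \<open>y\<close> of the cut contained in \<open>S\<close> serves
    here, since all vertices of \<open>A\<close> have degree \<open>d\<close>.\<close>
  have lb: "d \<le> card S" if S: "S \<subseteq> E" "\<not> connected_graph V (E - S)" for S
  proof -
    obtain A where A: "A \<subseteq> V" "A \<noteq> {}" "x \<notin> A" "edge_cut E A \<subseteq> S"
      using disconnecting_set_contains_cut [OF G x(1) S(2)] .
    then obtain y where y: "y \<in> A"
      by auto
    then have "d = degree E y"
      using A deg by auto
    also have "\<dots> \<le> card (edge_cut E A)"
      using degree_le_card_edge_cut [OF G dom A(1,3) y] .
    also have "\<dots> \<le> card S"
      using A(4) finite_subset [OF S(1) fE] by (intro card_mono)
    finally show ?thesis .
  qed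
  have "edge_connectivity V E = d"
  proof (rule antisym)
    show "edge_connectivity V E \<le> d"
      using edge_connectivity_le_degree [of v V E] v x deg by auto
    show "d \<le> edge_connectivity V E"
      using edge_connectivity_attained [OF x(1,2)] lb by metis
  qed
  moreover have "edge_connectivity V (E - {e}) < d"
  proof -
    have "edge_connectivity V (E - {e}) \<le> degree (E - {e}) v"
      using v x by (intro edge_connectivity_le_degree) auto
    also have "\<dots> < degree E v"
      unfolding degree_def using fE e v by (intro psubset_card_mono) auto
    finally show ?thesis
      using deg v by simp
  qed
  moreover have "d \<le> Suc (edge_connectivity V (E - {e}))"
  proof -
    obtain S where S: "S \<subseteq> E - {e}" "card S = edge_connectivity V (E - {e})"
        "\<not> connected_graph V (E - {e} - S)"
      using edge_connectivity_attained [OF x(1,2)] .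
    have "E - {e} - S = E - insert e S"
      by auto
    then have "d \<le> card (insert e S)"
      using S e by (intro lb) auto
    also have "\<dots> \<le> Suc (card S)"
      by (rule card_insert_le_m1) simp_all
    finally show ?thesis
      using S by simp
  qed
  ultimately show
    "int (edge_connectivity V (E - {e})) = int (edge_connectivity V E) - 1"
    by linarith
qed

theorem theorem2p1:
  fixes V :: "'a set" and E :: "'a set set" and x :: 'a
  assumes "finite_simple_graph V E"
    and "\<not> complete_graph V E"
    and "dominating V E x"
  shows "minimally_edge_connected V E \<longleftrightarrow>
    (\<forall>y. dominating V E y \<longrightarrow> y = x) \<and>
    regular_graph (V - {x}) (delete_vertex_edges E x)"
proof
  assume min: "minimally_edge_connected V E"
  note deg = minimally_edge_connected_imp_degree [OF assms(1,3) min]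
  have "y = x" if y: "dominating V E y" for y
  proof (rule ccontr)
    assume "y \<noteq> x"
    with y have yV: "y \<in> V - {x}"
      by (simp add: dominating_def)
    \<comment> \<open>The degree of \<open>y\<close> is the edge connectivity, which bounds every
      degree from below. The vertex \<open>x\<close> is treated apart because \<open>deg\<close>
      speaks only of the others.\<close>
    have "degree E y \<le> degree E v" if "v \<in> V" for v
    proof (cases "v = x")
      case True
      have "V \<noteq> {x}"
        using yV by auto
      then show ?thesis
        using True that deg [OF yV] edge_connectivity_le_degree [of x V E] by simp
    next
      case False
      then show ?thesis
        using that deg yV by simp
    qed
    with assms(2) complete_if_dominating_degree [OF assms(1) y] show False
      by blast
  qed
  moreover have "regular_graph (V - {x}) (delete_vertex_edges E x)"
    unfolding regular_graph_def
  proof (intro exI ballI)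
    fix v
    assume "v \<in> V - {x}"
    \<comment> \<open>The subtraction is not truncated: the edge connectivity equals
      \<open>degree E v\<close>, which is a successor.\<close>
    then show "degree (delete_vertex_edges E x) v = edge_connectivity V E - 1"
      using deg degree_delete_vertex_edges [OF assms(1,3)] by fastforce
  qed
  ultimately show "(\<forall>y. dominating V E y \<longrightarrow> y = x) \<and>
    regular_graph (V - {x}) (delete_vertex_edges E x)"
    by blast
next
  assume "(\<forall>y. dominating V E y \<longrightarrow> y = x) \<and>
    regular_graph (V - {x}) (delete_vertex_edges E x)"
  then obtain r where "\<And>v. v \<in> V - {x} \<Longrightarrow> degree (delete_vertex_edges E x) v = r"
    by (auto simp: regular_graph_def)
  then have "degree E v = Suc r" if "v \<in> V - {x}" for v
    using that degree_delete_vertex_edges [OF assms(1,3)] by simp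
  then show "minimally_edge_connected V E"
    by (rule minimally_edge_connected_if_degree [OF assms(1,3)])
qed

end
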